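(* Let $\sigma\in(-d,0)$. Then $\gamma^\sigma_R$ is monotonically increasing with respect to $R\in(0,+\infty)$ with $\lim_{R\to+\infty}\gamma^\sigma_R=+\infty$, and for every $E\in\mathcal{M}_{\mathrm f}(\mathbb{R}^d)$ with $|E|>0$, $H^\sigma_R(E)$ is monotonically increasing with respect to $R$ with $\lim_{R\to+\infty}H^\sigma_R(E)=+\infty$. Moreover, for every $E\in\mathcal{M}_{\mathrm f}(\mathbb{R}^d)$, $\hat H^\sigma_R(E)$ is monotonically non-increasing with respect to $R$ and $$\hat J^\sigma(E)=\lim_{R\to+\infty}\hat H^\sigma_R(E).$$ Furthermore, for every $R>0$ (and every $\sigma\in(-d,0)$), $$0\le\hat H^\sigma_R(E)-\hat J^\sigma(E)\le\frac{|E|^2}{R^{d+\sigma}}\qquad\text{for all }E\in\mathcal{M}_{\mathrm f}(\mathbb{R}^d).$$ Finally, $\hat J^\sigma$ is the $\Gamma$-limit of the functionals $\hat H^\sigma_R$ as $R\to+\infty$ with respect to the strong $L^1$ topology.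
   Context: Let $d\ge1$, let $|E|$ denote Lebesgue measure in $\mathbb{R}^d$, $\omega_d$ the measure of the unit ball, $B_\rho(x)$ the ball of radius $\rho$ and center $x$, and $\chi_E$ the characteristic function of $E$. $\mathcal{M}_{\mathrm f}(\mathbb{R}^d)$ is the family of measurable sets $E\subset\mathbb{R}^d$ with $|E|<+\infty$. For $\sigma\in(-d,0)$, $R>0$ and $E\in\mathcal{M}_{\mathrm f}(\mathbb{R}^d)$ set $$\gamma^\sigma_R:=d\omega_d\frac{1-R^{-\sigma}}{\sigma},\qquad H^\sigma_R(E):=\int_E\int_{B_R(x)\setminus E}\frac{1}{|x-y|^{d+\sigma}}\,dy\,dx,\qquad \hat H^\sigma_R(E):=H^\sigma_R(E)-\gamma^\sigma_R|E|,$$ $$\hat J^\sigma(E):=-\int_E\int_E\frac{1}{|x-y|^{d+\sigma}}\,dy\,dx-\frac{d\omega_d}{\sigma}|E|.$$ $\Gamma$-convergence as $R\to+\infty$ with respect to the strong $L^1$ topology is understood on $\mathcal{M}_{\mathrm f}(\mathbb{R}^d)$, with convergence $E_n\to E$ meaning $\chi_{E_n}\to\chi_E$ in $L^1(\mathbb{R}^d)$: for every sequence $R_n\to+\infty$, (liminf) $\hat J^\sigma(E)\le\liminf_n\hat H^\sigma_{R_n}(E_n)$ whenever $E_n\to E$, and (limsup) for every $E$ there is $E_n\to E$ with $\hat J^\sigma(E)\ge\limsup_n\hat H^\sigma_{R_n}(E_n)$. *)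

theory Defs
  imports "HOL-Analysis.Analysis"
begin

text \<open>
  Euclidean space of dimension \<open>d \<ge> 1\<close> is a type of class \<open>euclidean_space\<close>, with
  \<open>d = DIM('a)\<close>; the sets of finite Lebesgue measure form \<open>lmeasurable\<close>.
\<close>

definition riesz_gamma :: "'a::euclidean_space itself \<Rightarrow> real \<Rightarrow> real \<Rightarrow> real" where
  "riesz_gamma _ \<sigma> R =
     real DIM('a) * measure lebesgue (ball (0::'a) 1) * ((1 - R powr (- \<sigma>)) / \<sigma>)"

text \<open>
  The double integrals have nonnegative integrands and are taken in \<open>[0, \<infinity>]\<close>, so that no
  integrability is presupposed; the renormalized functionals are accordingly extended-real valued.
  On the diagonal \<open>x = y\<close> the kernel takes the value \<open>0\<close> instead of \<open>\<infinity>\<close>, which is immaterial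
  because for each \<open>x\<close> this concerns a single \<open>y\<close>.
\<close>

definition riesz_kernel :: "real \<Rightarrow> 'a::euclidean_space \<Rightarrow> 'a \<Rightarrow> ennreal" where
  "riesz_kernel \<sigma> x y = ennreal (1 / norm (x - y) powr (real DIM('a) + \<sigma>))"

definition riesz_H :: "real \<Rightarrow> real \<Rightarrow> 'a::euclidean_space set \<Rightarrow> ennreal" where
  "riesz_H \<sigma> R E =
     (\<integral>\<^sup>+ x\<in>E. (\<integral>\<^sup>+ y\<in>ball x R - E. riesz_kernel \<sigma> x y \<partial>lebesgue) \<partial>lebesgue)"

definition riesz_H_hat :: "real \<Rightarrow> real \<Rightarrow> 'a::euclidean_space set \<Rightarrow> ereal" where
  "riesz_H_hat \<sigma> R E =
     enn2ereal (riesz_H \<sigma> R E) - ereal (riesz_gamma TYPE('a) \<sigma> R * measure lebesgue E)"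

definition riesz_J_hat :: "real \<Rightarrow> 'a::euclidean_space set \<Rightarrow> ereal" where
  "riesz_J_hat \<sigma> E =
     - enn2ereal (\<integral>\<^sup>+ x\<in>E. (\<integral>\<^sup>+ y\<in>E. riesz_kernel \<sigma> x y \<partial>lebesgue) \<partial>lebesgue)
     - ereal (real DIM('a) * measure lebesgue (ball (0::'a) 1) / \<sigma> * measure lebesgue E)"

definition L1_set_conv :: "(nat \<Rightarrow> 'a::euclidean_space set) \<Rightarrow> 'a set \<Rightarrow> bool" where
  "L1_set_conv En E \<longleftrightarrow>
     (\<lambda>n. \<integral>\<^sup>+ x. ennreal \<bar>indicat_real (En n) x - indicat_real E x\<bar> \<partial>lebesgue) \<longlonglongrightarrow> 0"

definition Gamma_limit_at_top ::
  "(real \<Rightarrow> 'a::euclidean_space set \<Rightarrow> ereal) \<Rightarrow> ('a set \<Rightarrow> ereal) \<Rightarrow> bool" where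
  "Gamma_limit_at_top F G \<longleftrightarrow>
     (\<forall>R :: nat \<Rightarrow> real. (\<forall>n. 0 < R n) \<longrightarrow> filterlim R at_top sequentially \<longrightarrow>
        (\<forall>E \<in> lmeasurable. \<forall>En. (\<forall>n. En n \<in> lmeasurable) \<longrightarrow> L1_set_conv En E \<longrightarrow>
           G E \<le> liminf (\<lambda>n. F (R n) (En n))) \<and>
        (\<forall>E \<in> lmeasurable. \<exists>En. (\<forall>n. En n \<in> lmeasurable) \<and> L1_set_conv En E \<and>
           G E \<ge> limsup (\<lambda>n. F (R n) (En n))))"

end

theory Submission
  imports Defs
begin

text \<open>
  Put \<open>k(z) = \<bar>z\<bar> powr - (d + \<sigma>)\<close>, let \<open>K\<^sub>R\<close> be its integral over the ball of radius \<open>R\<close> and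
  let \<open>N\<^sub>R(E)\<close> be the energy of the pairs in \<open>E \<times> E\<close> at distance less than \<open>R\<close>. Everything is finite
  for \<open>-d < \<sigma> < 0\<close>, and \<open>H\<^sub>R(E) = K\<^sub>R \<bar>E\<bar> - N\<^sub>R(E)\<close>, while \<open>\<gamma>\<^sub>R = K\<^sub>R - K\<^sub>1\<close>. So the renormalized functional is
  \<open>K\<^sub>1 \<bar>E\<bar> - N\<^sub>R(E)\<close>, which decreases to \<open>K\<^sub>1 \<bar>E\<bar> - N\<^sub>\<infinity>(E)\<close>; the error is the energy of the pairs at distance
  at least \<open>R\<close>, where \<open>k \<le> R powr - (d + \<sigma>)\<close>.

  If \<open>H\<^sub>R(E)\<close> were not strictly increasing in \<open>R\<close>, then for almost every \<open>x \<in> E\<close> an annulus around \<open>x\<close>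
  would lie in \<open>E\<close> up to a null set. Hence \<open>E + v \<subseteq> E\<close> a.e. for some \<open>v \<noteq> 0\<close>, which forces a set of finite
  measure to be null.

  Since the functionals decrease to their limit, constant sequences are recovery sequences, and the
  lower bound reduces to the lower semicontinuity of the limit. This follows from
  \<open>N\<^sub>\<infinity>(F) \<le> N\<^sub>\<infinity>(E) + 2 \<bar>F - E\<bar> (K\<^sub>1 + \<bar>F\<bar>)\<close>.
\<close>

section \<open>The integral of the kernel over a ball\<close>

text \<open>The antiderivative is \<open>- (t powr (- s))\<close>. With \<open>a = norm z\<close>
  this is the layer-cake formula for the radial kernel inside the ball of radius
  \<open>R\<close>.\<close>

lemma set_nn_integral_powr_Icc:
  assumes "0 < s" "0 < a" "a \<le> R"
  shows "(\<integral>\<^sup>+ t\<in>{a..R}. ennreal (s * t powr (- s - 1)) \<partial>lborel) = ennreal (a powr (- s) - R powr (- s))"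
proof -
  have "((\<lambda>t. - (t powr (- s))) has_real_derivative s * t powr (- s - 1)) (at t within {a..R})"
    if "t \<in> {a..R}" for t
    using that assms by (auto intro!: derivative_eq_intros)
  then have "((\<lambda>t. s * t powr (- s - 1)) has_integral (- (R powr (- s)) - - (a powr (- s)))) {a..R}"
    using assms by (intro fundamental_theorem_of_calculus)
      (auto simp: has_real_derivative_iff_has_vector_derivative[symmetric])
  then show ?thesis
    using assms by (subst nn_integral_has_integral_lebesgue') auto
qed

lemma set_nn_integral_norm_powr_ball:
  fixes s R :: real
  assumes s: "0 < s" "s < DIM('a::euclidean_space)" and R: "0 < R"
  shows "(\<integral>\<^sup>+ z\<in>ball (0::'a) R. ennreal (1 / norm z powr s) \<partial>lborel) =
    ennreal (DIM('a) * measure lebesgue (ball (0::'a) 1) * R powr (DIM('a) - s) / (DIM('a) - s))"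
proof -
  define d where "d = real DIM('a)"
  define w where "w = measure lebesgue (ball (0::'a) 1)"
  have w: "0 \<le> w" by (simp add: w_def)
  \<comment> \<open>Layer cake: \<open>\<bar>z\<bar>\<^sup>-\<^sup>s = R\<^sup>-\<^sup>s + \<integral> s t\<^sup>-\<^sup>s\<^sup>-\<^sup>1 dt\<close> over \<open>\<bar>z\<bar> \<le> t \<le> R\<close>, then Tonelli.\<close>
  define f where "f = (\<lambda>(z::'a) t. ennreal (s * t powr (- s - 1)) * indicator {x. norm (fst x) \<le> snd x \<and> snd x \<le> R} (z, t))"
  have f [measurable]: "case_prod f \<in> borel_measurable (lborel \<Otimes>\<^sub>M lborel)"
    unfolding f_def by (simp add: split_beta') measurable
  have mball: "emeasure lborel (ball (0::'a) t) = ennreal (w * t powr d)" if "0 \<le> t" for t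
    using that by (cases "t = 0") (auto simp: emeasure_ball content_ball w_def d_def powr_realpow)
  have mcball: "emeasure lborel (cball (0::'a) t) = ennreal (w * t powr d)" if "0 \<le> t" for t
    using that mball[of t] by (simp add: emeasure_ball emeasure_cball)
  \<comment> \<open>The origin must be excluded: there the left side takes the default value
    \<open>1 / 0 = 0\<close>, whereas the integral over \<open>t\<close> diverges.\<close>
  have inner: "ennreal (1 / norm z powr s) * indicator (ball 0 R) z =
      ennreal (R powr (- s)) * indicator (ball 0 R) z + (\<integral>\<^sup>+ t. f z t \<partial>lborel)" if "z \<noteq> 0" for z :: 'a
  proof (cases "norm z < R")
    case True
    have "(\<integral>\<^sup>+ t. f z t \<partial>lborel) = (\<integral>\<^sup>+ t\<in>{norm z..R}. ennreal (s * t powr (- s - 1)) \<partial>lborel)"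
      by (intro nn_integral_cong) (auto simp: f_def split: split_indicator)
    also have "\<dots> = ennreal (norm z powr (- s) - R powr (- s))"
      using s that True by (intro set_nn_integral_powr_Icc) auto
    finally have "(\<integral>\<^sup>+ t. f z t \<partial>lborel) = ennreal (norm z powr (- s) - R powr (- s))" .
    moreover have "R powr (- s) \<le> norm z powr (- s)"
      using True s that by (intro powr_mono2') auto
    ultimately have "ennreal (R powr (- s)) + (\<integral>\<^sup>+ t. f z t \<partial>lborel) = ennreal (norm z powr (- s))"
      by (simp add: ennreal_plus[symmetric] del: ennreal_plus)
    then show ?thesis
      using True by (simp add: powr_minus_divide)
  next
    case False
    \<comment> \<open>Now \<open>norm z \<ge> R\<close>, so the constraints
      \<open>norm z \<le> t \<le> R\<close> leave at most the single point
      \<open>t = R\<close>.\<close>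
    have "(\<integral>\<^sup>+ t. f z t \<partial>lborel) = (\<integral>\<^sup>+ t. 0 \<partial>(lborel :: real measure))"
      using False by (intro nn_integral_cong_AE eventually_mono[OF AE_lborel_singleton[of R]])
        (auto simp: f_def split: split_indicator)
    then show ?thesis using False by simp
  qed
  have "(\<integral>\<^sup>+ z\<in>ball (0::'a) R. ennreal (1 / norm z powr s) \<partial>lborel) =
     (\<integral>\<^sup>+ z. ennreal (R powr (- s)) * indicator (ball 0 R) z + (\<integral>\<^sup>+ t. f z t \<partial>lborel) \<partial>lborel)"
    by (intro nn_integral_cong_AE eventually_mono[OF AE_lborel_singleton[of 0]]) (rule inner)
  also have "\<dots> = (\<integral>\<^sup>+ z\<in>ball (0::'a) R. ennreal (R powr (- s)) \<partial>lborel) +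
     (\<integral>\<^sup>+ z. (\<integral>\<^sup>+ t. f z t \<partial>lborel) \<partial>lborel)"
    by (rule nn_integral_add[OF borel_measurable_times_ennreal[OF measurable_const borel_measurable_indicator]
          lborel.borel_measurable_nn_integral[OF f]]) simp_all
  also have "(\<integral>\<^sup>+ z\<in>ball (0::'a) R. ennreal (R powr (- s)) \<partial>lborel) =
      ennreal (R powr (- s)) * emeasure lborel (ball (0::'a) R)"
    by (rule nn_integral_cmult_indicator) simp
  also have "(\<integral>\<^sup>+ z. (\<integral>\<^sup>+ t. f z t \<partial>lborel) \<partial>lborel) = (\<integral>\<^sup>+ t. (\<integral>\<^sup>+ z. f z t \<partial>lborel) \<partial>lborel)"
    by (rule lborel_pair.Fubini'[symmetric]) (rule f)
  also have "\<dots> = (\<integral>\<^sup>+ t\<in>{0..R}. ennreal (s * w * t powr (d - s - 1)) \<partial>lborel)"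
  proof (intro nn_integral_cong)
    fix t :: real
    have "(\<integral>\<^sup>+ z. f z t \<partial>lborel) = (\<integral>\<^sup>+ z. ennreal (s * t powr (- s - 1)) * indicator {..R} t * indicator (cball (0::'a) t) z \<partial>lborel)"
      by (intro nn_integral_cong) (auto simp: f_def split: split_indicator)
    also have "\<dots> = ennreal (s * t powr (- s - 1)) * indicator {..R} t * emeasure lborel (cball (0::'a) t)"
      by (rule nn_integral_cmult_indicator) simp
    also have "\<dots> = ennreal (s * w * t powr (d - s - 1)) * indicator {0..R} t"
    proof (cases "0 < t")
      case True
      have "s * t powr (- s - 1) * (w * t powr d) = s * w * t powr (d - s - 1)"
        using True by (simp add: powr_add[symmetric] mult_ac) (simp add: algebra_simps)
      then show ?thesis using True s w
        by (auto simp: mcball ennreal_mult[symmetric] split: split_indicator)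
    next
      case False
      \<comment> \<open>For \<open>t < 0\<close> the closed ball is empty; for \<open>t = 0\<close>
        both sides vanish because \<open>0 powr _ = 0\<close>.\<close>
      then show ?thesis by (cases "t = 0") (auto simp: indicator_def)
    qed
    finally show "(\<integral>\<^sup>+ z. f z t \<partial>lborel) = ennreal (s * w * t powr (d - s - 1)) * indicator {0..R} t" .
  qed
  also have "\<dots> = ennreal (s * w * (R powr (d - s) / (d - s)))"
    using has_integral_mult_right[OF has_integral_powr_from_0[of "d - s - 1" R], of "s * w"] s R w
    by (subst nn_integral_has_integral_lebesgue') (auto simp: d_def)
  also have "ennreal (R powr (- s)) * emeasure lborel (ball (0::'a) R) + \<dots> =
      ennreal (R powr (- s) * (w * R powr d) + s * w * (R powr (d - s) / (d - s)))"
    using R s w by (simp add: mball ennreal_mult d_def)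
  also have "R powr (- s) * (w * R powr d) = w * R powr (d - s)"
    using R by (simp add: powr_add[symmetric] mult_ac)
  also have "w * R powr (d - s) + s * w * (R powr (d - s) / (d - s)) = d * w * R powr (d - s) / (d - s)"
    using s by (simp add: d_def field_simps)
  finally show ?thesis by (simp add: d_def w_def)
qed

section \<open>Sets containing a translate of themselves\<close>

lemma AE_lborel_translation:
  fixes P :: "'a::euclidean_space \<Rightarrow> bool"
  assumes "AE x in lborel. P x" and [measurable]: "Measurable.pred borel P"
  shows "AE x in lborel. P (c + x)"
proof -
  have "AE x in distr lborel borel ((+) c). P x"
    unfolding lborel_distr_plus by fact
  then show ?thesis
    by (subst (asm) AE_distr_iff) auto
qed

text \<open>Iteration gives the inclusion for every multiple of \<open>v\<close>, so the mass of
  \<open>B\<close> inside any ball is at most its mass outside. As the radius grows, the former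
  tends to the measure of \<open>B\<close> and the latter, by finiteness, to 0.\<close>

lemma emeasure_eq_0_if_translation_subset:
  fixes B :: "'a::euclidean_space set"
  assumes B [measurable]: "B \<in> sets borel" and fin: "emeasure lborel B < \<infinity>" and "v \<noteq> 0"
    and sub: "AE x in lborel. x \<in> B \<longrightarrow> v + x \<in> B"
  shows "emeasure lborel B = 0"
proof -
  have iter: "AE x in lborel. x \<in> B \<longrightarrow> real n *\<^sub>R v + x \<in> B" for n
  proof (induction n)
    case (Suc n)
    then have "AE x in lborel. v + x \<in> B \<longrightarrow> real n *\<^sub>R v + (v + x) \<in> B"
      by (rule AE_lborel_translation) measurable
    with sub show ?case
      by eventually_elim (auto simp: algebra_simps)
  qed simp
  \<comment> \<open>A large multiple of \<open>v\<close> moves \<open>B \<inter> ball 0 M\<close> into \<open>B\<close>, but out of the ball.\<close>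
  have le: "emeasure lborel (B \<inter> ball 0 (real M)) \<le> emeasure lborel (B - ball 0 (real M))" for M
  proof -
    \<comment> \<open>The shift by \<open>n\<close> times \<open>v\<close> must be at least the
      diameter \<open>2 * M\<close> of the ball.\<close>
    obtain n :: nat where n: "2 * real M / norm v \<le> n"
      using real_arch_simple by blast
    define w where "w = real n *\<^sub>R v"
    have w: "2 * real M \<le> norm w"
      using n \<open>v \<noteq> 0\<close> by (simp add: w_def field_simps)
    have "AE x in lborel. - w + x \<in> B \<longrightarrow> w + (- w + x) \<in> B"
      using iter[of n] unfolding w_def by (rule AE_lborel_translation) measurable
    then have ae: "AE x in lborel. x \<in> {x. - w + x \<in> B \<inter> ball 0 (real M)} \<longrightarrow> x \<in> B - ball 0 (real M)"
    proof eventually_elim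
      case (elim x)
      have "norm w \<le> norm x + norm (- w + x)"
        using norm_triangle_ineq4[of x "- w + x"] by simp
      with elim w show ?case by auto
    qed
    have "emeasure lborel (B \<inter> ball 0 (real M)) = emeasure (distr lborel borel ((+) (- w))) (B \<inter> ball 0 (real M))"
      unfolding lborel_distr_plus ..
    also have "\<dots> = emeasure lborel {x. - w + x \<in> B \<inter> ball 0 (real M)}"
      by (subst emeasure_distr) (auto simp: vimage_def)
    also have "\<dots> \<le> emeasure lborel (B - ball 0 (real M))"
      by (rule emeasure_mono_AE[OF ae]) auto
    finally show ?thesis .
  qed
  have "(\<lambda>M. emeasure lborel (B \<inter> ball 0 (real M))) \<longlonglongrightarrow> emeasure lborel (\<Union>M. B \<inter> ball 0 (real M))"
    by (rule Lim_emeasure_incseq) (auto simp: incseq_def)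
  also have "(\<Union>M. B \<inter> ball 0 (real M)) = B"
    using reals_Archimedean2 by auto
  finally have inner: "(\<lambda>M. emeasure lborel (B \<inter> ball 0 (real M))) \<longlonglongrightarrow> emeasure lborel B" .
  have "(\<lambda>M. emeasure lborel (B - ball 0 (real M))) \<longlonglongrightarrow> emeasure lborel (\<Inter>M. B - ball 0 (real M))"
  proof (rule Lim_emeasure_decseq)
    show "emeasure lborel (B - ball 0 (real i)) \<noteq> \<infinity>" for i
      using emeasure_mono[of "B - ball 0 (real i)" B lborel] fin by (auto simp: top_unique)
  qed (auto simp: decseq_def)
  also have "(\<Inter>M. B - ball 0 (real M)) = {}"
  proof -
    have "\<exists>M. norm x < real M" for x :: 'a by (rule reals_Archimedean2)
    then show ?thesis by fastforce
  qed
  finally have outer: "(\<lambda>M. emeasure lborel (B - ball 0 (real M))) \<longlonglongrightarrow> 0" by simp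
  show ?thesis
    using LIMSEQ_le[OF inner outer] le by auto
qed

text \<open>The annulus has positive measure: it contains the ball of radius
  \<open>(R - r) / 2\<close> about a point \<open>p\<close> at the mean distance
  \<open>(r + R) / 2\<close> from the origin.\<close>

lemma ex_annulus_if_AE:
  assumes ae: "AE v in lborel. P (v::'a::euclidean_space)" and R: "0 < r" "r < R"
  shows "\<exists>v. r \<le> norm v \<and> norm v < R \<and> P v"
proof (rule ccontr)
  assume "\<not> ?thesis"
  obtain b :: 'a where b: "b \<in> Basis" using nonempty_Basis by blast
  define p where "p = ((r + R) / 2) *\<^sub>R b"
  have p: "norm p = (r + R) / 2" using b R by (simp add: p_def)
  have "r \<le> norm v \<and> norm v < R" if "v \<in> ball p ((R - r) / 2)" for v
    using that p norm_triangle_ineq2[of p v] norm_triangle_ineq2[of v p]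
    by (simp add: dist_norm norm_minus_commute field_simps)
  with \<open>\<not> ?thesis\<close> have "AE v in lborel. v \<notin> ball p ((R - r) / 2)"
    using ae by (auto elim: eventually_mono)
  then have "emeasure lborel (ball p ((R - r) / 2)) = 0"
    by (subst (asm) AE_iff_measurable[OF _ refl]) (auto simp: ball_def)
  then show False
    using content_ball_pos[of "(R - r) / 2" p] R by (simp add: measure_def)
qed

text \<open>
  By Fubini the hypothesis yields a single \<open>v \<noteq> 0\<close> with \<open>E + v \<subseteq> E\<close> up to a null set.
\<close>
lemma emeasure_eq_0_if_annuli_subset:
  fixes E :: "'a::euclidean_space set"
  assumes E: "E \<in> lmeasurable" and R: "0 < r" "r < R"
    and ae: "AE x in lebesgue. x \<in> E \<longrightarrow> (AE y in lebesgue. r \<le> dist x y \<longrightarrow> dist x y < R \<longrightarrow> y \<in> E)"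
  shows "emeasure lebesgue E = 0"
proof -
  \<comment> \<open>A Borel hull differing from \<open>E\<close> by a null set: translation and
    Fubini are then applied to \<open>lborel\<close> and Borel predicates.\<close>
  obtain B where B: "E \<subseteq> B" "B \<in> sets lborel" "B - E \<in> null_sets lebesgue"
    and eB: "emeasure lebesgue E = emeasure lborel B"
    using completion_upper[of E lborel] E by auto
  note [measurable] = B(2)[simplified]
  have BE: "AE x in lebesgue. x \<in> B \<longleftrightarrow> x \<in> E"
    using AE_not_in[OF B(3)] B(1) by (auto elim: eventually_mono)
  have "AE x in lebesgue. AE y in lebesgue. x \<in> B \<longrightarrow> r \<le> dist x y \<longrightarrow> dist x y < R \<longrightarrow> y \<in> B"
    using ae BE
  proof eventually_elim
    case (elim x)
    show ?case
    proof (cases "x \<in> B")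
      case True
      with elim have "AE y in lebesgue. r \<le> dist x y \<longrightarrow> dist x y < R \<longrightarrow> y \<in> E" by simp
      with BE show ?thesis by eventually_elim auto
    qed simp
  qed
  then have "AE x in lborel. AE y in lborel. x \<in> B \<longrightarrow> r \<le> dist x y \<longrightarrow> dist x y < R \<longrightarrow> y \<in> B"
    by (simp add: AE_completion_iff)
  then have "AE x in lborel. AE v in lborel. x \<in> B \<longrightarrow> r \<le> norm v \<longrightarrow> norm v < R \<longrightarrow> x + v \<in> B"
  proof eventually_elim
    case (elim x)
    then have "AE v in lborel. x \<in> B \<longrightarrow> r \<le> dist x (x + v) \<longrightarrow> dist x (x + v) < R \<longrightarrow> x + v \<in> B"
      by (rule AE_lborel_translation) measurable
    then show ?case by (simp add: dist_norm)
  qed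
  then have "AE v in lborel. AE x in lborel. x \<in> B \<longrightarrow> r \<le> norm v \<longrightarrow> norm v < R \<longrightarrow> x + v \<in> B"
    by (rule lborel_pair.AE_commute[THEN iffD1, rotated]) measurable
  from ex_annulus_if_AE[OF this R] obtain v where v: "r \<le> norm v" "norm v < R"
    and "AE x in lborel. x \<in> B \<longrightarrow> r \<le> norm v \<longrightarrow> norm v < R \<longrightarrow> x + v \<in> B" by blast
  then have "AE x in lborel. x \<in> B \<longrightarrow> v + x \<in> B" by (simp add: add.commute)
  moreover have "emeasure lborel B < \<infinity>" using E eB by (auto simp: fmeasurable_def)
  moreover have "v \<noteq> 0" using v R by auto
  ultimately show ?thesis
    unfolding eB using B(2) by (intro emeasure_eq_0_if_translation_subset) auto
qed

section \<open>Measurability on products of Lebesgue measures\<close>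

lemma sigma_finite_lebesgue: "sigma_finite_measure (lebesgue :: 'a::euclidean_space measure)"
proof
  obtain A :: "'a set set" where A: "countable A" "A \<subseteq> sets lborel" "\<Union>A = space lborel" "\<forall>a\<in>A. emeasure lborel a \<noteq> \<infinity>"
    using lborel.sigma_finite_countable by blast
  then show "\<exists>A::'a set set. countable A \<and> A \<subseteq> sets lebesgue \<and> \<Union>A = space lebesgue \<and> (\<forall>a\<in>A. emeasure lebesgue a \<noteq> \<infinity>)"
    by (intro exI[of _ A]) auto
qed

interpretation lebesgue: sigma_finite_measure "lebesgue :: 'a::euclidean_space measure"
  by (rule sigma_finite_lebesgue)

interpretation lebesgue_pair: pair_sigma_finite "lebesgue :: 'a::euclidean_space measure" "lebesgue :: 'b::euclidean_space measure"
  ..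

text \<open>Every Borel set is Lebesgue measurable, so the identity from the product of the
  completions to the Borel product is measurable, and Borel functions pull back along it.\<close>

lemma measurable_lebesgue_pair:
  assumes "g \<in> borel_measurable borel"
  shows "(g :: 'a::euclidean_space \<times> 'b::euclidean_space \<Rightarrow> 'c::topological_space) \<in> borel_measurable (lebesgue \<Otimes>\<^sub>M lebesgue)"
proof -
  have "(\<lambda>p. p) \<in> (lebesgue :: 'a measure) \<Otimes>\<^sub>M (lebesgue :: 'b measure) \<rightarrow>\<^sub>M borel \<Otimes>\<^sub>M borel"
    by (subst measurable_pair_iff)
      (auto simp: comp_def intro!: measurable_compose[OF measurable_fst] measurable_compose[OF measurable_snd]
        simp flip: id_def)
  then show ?thesis
    using measurable_compose assms unfolding borel_prod by blast
qed

lemma measurable_riesz_kernel: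
  "(\<lambda>p. riesz_kernel \<sigma> (fst p) (snd p)) \<in> borel_measurable borel"
  unfolding riesz_kernel_def borel_prod[symmetric] by measurable

section \<open>Interaction energies restricted to a set of pairs\<close>

text \<open>A common form for all double integrals: \<open>D = near R\<close> and
  \<open>F = - E\<close> give \<open>riesz_H\<close>, \<open>D = UNIV\<close> and
  \<open>F = E\<close> the integral in \<open>riesz_J_hat\<close>, and \<open>D = - near R\<close>
  the tail. Additivity in \<open>D\<close> and in \<open>F\<close> relates them.\<close>

definition riesz_energy ::
  "real \<Rightarrow> ('a \<times> 'a) set \<Rightarrow> 'a set \<Rightarrow> 'a::euclidean_space set \<Rightarrow> ennreal" where
  "riesz_energy \<sigma> D E F =
     (\<integral>\<^sup>+ x\<in>E. (\<integral>\<^sup>+ y\<in>F. riesz_kernel \<sigma> x y * indicator D (x, y) \<partial>lebesgue) \<partial>lebesgue)"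

definition near :: "real \<Rightarrow> ('a::euclidean_space \<times> 'a) set" where
  "near R = {(x, y). dist x y < R}"

lemma near_sets [measurable]: "near R \<in> sets borel"
  unfolding near_def case_prod_beta by (intro borel_open open_Collect_less) (auto intro!: continuous_intros)

lemma measurable_riesz_integrand:
  assumes "D \<in> sets borel" "F \<in> sets lebesgue"
  shows "(\<lambda>(x, y). riesz_kernel \<sigma> x y * indicator D (x, y) * indicator F y) \<in> borel_measurable (lebesgue \<Otimes>\<^sub>M lebesgue)"
proof -
  have "(\<lambda>p. riesz_kernel \<sigma> (fst p) (snd p) * indicator D p) \<in> borel_measurable (lebesgue \<Otimes>\<^sub>M lebesgue)"
    using assms measurable_riesz_kernel
    by (intro measurable_lebesgue_pair borel_measurable_times_ennreal borel_measurable_indicator) auto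
  moreover have "(\<lambda>p. indicator F (snd p) :: ennreal) \<in> borel_measurable (lebesgue \<Otimes>\<^sub>M lebesgue)"
    using assms by (intro measurable_compose[OF measurable_snd] borel_measurable_indicator)
  ultimately show ?thesis
    unfolding case_prod_beta prod.collapse by (rule borel_measurable_times_ennreal)
qed

lemma measurable_riesz_inner:
  assumes "D \<in> sets borel" "F \<in> sets lebesgue"
  shows "(\<lambda>x. \<integral>\<^sup>+ y\<in>F. riesz_kernel \<sigma> x y * indicator D (x, y) \<partial>lebesgue) \<in> borel_measurable lebesgue"
  by (rule lebesgue.borel_measurable_nn_integral[OF measurable_riesz_integrand[OF assms]])

lemma measurable_riesz_slice:
  assumes "D \<in> sets borel" "F \<in> sets lebesgue"
  shows "(\<lambda>y. riesz_kernel \<sigma> x y * indicator D (x, y) * indicator F y) \<in> borel_measurable lebesgue"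
  using measurable_compose_Pair1[OF _ measurable_riesz_integrand[OF assms], of x] by simp

lemma riesz_energy_eq_0_iff:
  assumes "D \<in> sets borel" "E \<in> sets lebesgue" "F \<in> sets lebesgue"
  shows "riesz_energy \<sigma> D E F = 0 \<longleftrightarrow>
    (AE x in lebesgue. x \<in> E \<longrightarrow> (AE y in lebesgue. y \<in> F \<longrightarrow> (x, y) \<in> D \<longrightarrow> riesz_kernel \<sigma> x y = 0))"
proof -
  have "(\<lambda>x. (\<integral>\<^sup>+ y\<in>F. riesz_kernel \<sigma> x y * indicator D (x, y) \<partial>lebesgue) * indicator E x) \<in> borel_measurable lebesgue"
    using assms by (intro borel_measurable_times_ennreal measurable_riesz_inner borel_measurable_indicator)
  then have "riesz_energy \<sigma> D E F = 0 \<longleftrightarrow> (AE x in lebesgue. x \<in> E \<longrightarrow>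
      (\<integral>\<^sup>+ y\<in>F. riesz_kernel \<sigma> x y * indicator D (x, y) \<partial>lebesgue) = 0)"
    unfolding riesz_energy_def
    by (subst nn_integral_0_iff_AE) (auto simp: indicator_def intro!: eventually_subst always_eventually)
  moreover have "(\<integral>\<^sup>+ y\<in>F. riesz_kernel \<sigma> x y * indicator D (x, y) \<partial>lebesgue) = 0 \<longleftrightarrow>
      (AE y in lebesgue. y \<in> F \<longrightarrow> (x, y) \<in> D \<longrightarrow> riesz_kernel \<sigma> x y = 0)" for x
    unfolding nn_integral_0_iff_AE[OF measurable_riesz_slice[OF assms(1,3)]]
    by (intro eventually_subst always_eventually) (auto simp: indicator_def)
  ultimately show ?thesis by simp
qed

lemma riesz_energy_Un_right:
  assumes "D \<in> sets borel" "E \<in> sets lebesgue" "F \<in> sets lebesgue" "G \<in> sets lebesgue" "F \<inter> G = {}"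
  shows "riesz_energy \<sigma> D E (F \<union> G) = riesz_energy \<sigma> D E F + riesz_energy \<sigma> D E G"
proof -
  have "(\<integral>\<^sup>+ y\<in>F \<union> G. riesz_kernel \<sigma> x y * indicator D (x, y) \<partial>lebesgue) =
    (\<integral>\<^sup>+ y\<in>F. riesz_kernel \<sigma> x y * indicator D (x, y) \<partial>lebesgue) +
    (\<integral>\<^sup>+ y\<in>G. riesz_kernel \<sigma> x y * indicator D (x, y) \<partial>lebesgue)" for x
    unfolding nn_integral_add[OF measurable_riesz_slice measurable_riesz_slice, OF assms(1,3,1,4), symmetric]
    using assms by (intro nn_integral_cong) (auto simp: indicator_def)
  then show ?thesis
    unfolding riesz_energy_def using assms
    by (simp add: distrib_right nn_integral_add borel_measurable_times_ennreal measurable_riesz_inner)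
qed

lemma riesz_energy_Un_domain:
  assumes "D \<in> sets borel" "D' \<in> sets borel" "E \<in> sets lebesgue" "F \<in> sets lebesgue" "D \<inter> D' = {}"
  shows "riesz_energy \<sigma> (D \<union> D') E F = riesz_energy \<sigma> D E F + riesz_energy \<sigma> D' E F"
proof -
  have "(\<integral>\<^sup>+ y\<in>F. riesz_kernel \<sigma> x y * indicator (D \<union> D') (x, y) \<partial>lebesgue) =
    (\<integral>\<^sup>+ y\<in>F. riesz_kernel \<sigma> x y * indicator D (x, y) \<partial>lebesgue) +
    (\<integral>\<^sup>+ y\<in>F. riesz_kernel \<sigma> x y * indicator D' (x, y) \<partial>lebesgue)" for x
    unfolding nn_integral_add[OF measurable_riesz_slice measurable_riesz_slice, OF assms(1,4,2,4), symmetric]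
    using assms by (intro nn_integral_cong) (auto simp: indicator_def)
  then show ?thesis
    unfolding riesz_energy_def using assms
    by (simp add: distrib_right nn_integral_add borel_measurable_times_ennreal measurable_riesz_inner)
qed

text \<open>Tonelli exchanges the integrals, and symmetry of the kernel and of \<open>D\<close> lets
  the variables be renamed. This carries additivity from the second set over to the first.\<close>

lemma riesz_energy_commute:
  assumes "D \<in> sets borel" "E \<in> sets lebesgue" "F \<in> sets lebesgue" "sym D"
  shows "riesz_energy \<sigma> D E F = riesz_energy \<sigma> D F E"
proof -
  have m: "(\<lambda>(x, y). riesz_kernel \<sigma> x y * indicator D (x, y) * indicator F y * indicator E x) \<in> borel_measurable (lebesgue \<Otimes>\<^sub>M lebesgue)"
  proof -
    have "(\<lambda>p. indicator E (fst p) :: ennreal) \<in> borel_measurable (lebesgue \<Otimes>\<^sub>M lebesgue)"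
      using assms by (intro measurable_compose[OF measurable_fst] borel_measurable_indicator)
    from borel_measurable_times_ennreal[OF measurable_riesz_integrand[OF assms(1,3)] this]
    show ?thesis unfolding case_prod_beta .
  qed
  have "riesz_energy \<sigma> D E F = (\<integral>\<^sup>+ x. (\<integral>\<^sup>+ y. riesz_kernel \<sigma> x y * indicator D (x, y) * indicator F y * indicator E x \<partial>lebesgue) \<partial>lebesgue)"
    unfolding riesz_energy_def by (intro nn_integral_cong nn_integral_multc[symmetric] measurable_riesz_slice assms)
  also have "\<dots> = (\<integral>\<^sup>+ y. (\<integral>\<^sup>+ x. riesz_kernel \<sigma> x y * indicator D (x, y) * indicator F y * indicator E x \<partial>lebesgue) \<partial>lebesgue)"
    by (rule lebesgue_pair.Fubini'[OF m, symmetric])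
  also have "\<dots> = (\<integral>\<^sup>+ y. (\<integral>\<^sup>+ x. riesz_kernel \<sigma> y x * indicator D (y, x) * indicator E x * indicator F y \<partial>lebesgue) \<partial>lebesgue)"
  proof -
    have "riesz_kernel \<sigma> x y = riesz_kernel \<sigma> y x" for x y :: 'a
      by (simp add: riesz_kernel_def norm_minus_commute)
    moreover have "indicator D (x, y) = (indicator D (y, x) :: ennreal)" for x y
      using \<open>sym D\<close> by (auto simp: indicator_def dest: symD)
    ultimately show ?thesis by (simp add: mult_ac)
  qed
  also have "\<dots> = riesz_energy \<sigma> D F E"
    unfolding riesz_energy_def by (intro nn_integral_cong nn_integral_multc measurable_riesz_slice assms)
  finally show ?thesis .
qed

lemma riesz_energy_mono:
  assumes "D \<subseteq> D'" "E \<subseteq> E'" "F \<subseteq> F'"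
  shows "riesz_energy \<sigma> D E F \<le> riesz_energy \<sigma> D' E' F'"
  unfolding riesz_energy_def using assms
  by (intro nn_integral_mono mult_mono) (auto simp: indicator_def)

section \<open>Bounds for near and far pairs\<close>

lemma riesz_energy_le:
  assumes E: "E \<in> sets lebesgue"
    and c: "\<And>x. x \<in> E \<Longrightarrow> (\<integral>\<^sup>+ y\<in>F. riesz_kernel \<sigma> x y * indicator D (x, y) \<partial>lebesgue) \<le> c"
  shows "riesz_energy \<sigma> D E F \<le> c * emeasure lebesgue E"
proof -
  have "riesz_energy \<sigma> D E F \<le> (\<integral>\<^sup>+ x\<in>E. c \<partial>lebesgue)"
    unfolding riesz_energy_def using c by (intro nn_integral_mono) (auto simp: indicator_def)
  also have "\<dots> = c * emeasure lebesgue E"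
    using E by (rule nn_integral_cmult_indicator)
  finally show ?thesis .
qed

lemma riesz_energy_far_le:
  assumes "0 < R" "- real DIM('a::euclidean_space) < \<sigma>" and E: "E \<in> sets lebesgue" and F: "(F :: 'a set) \<in> sets lebesgue"
  shows "riesz_energy \<sigma> (- near R) E F \<le> ennreal (1 / R powr (real DIM('a) + \<sigma>)) * emeasure lebesgue F * emeasure lebesgue E"
proof (rule riesz_energy_le[OF E])
  fix x
  \<comment> \<open>Pairs outside \<open>near R\<close> have distance at least \<open>R\<close>, and
    \<open>d + \<sigma> > 0\<close> makes the kernel decrease with the distance.\<close>
  have "(\<integral>\<^sup>+ y\<in>F. riesz_kernel \<sigma> x y * indicator (- near R) (x, y) \<partial>lebesgue) \<le> (\<integral>\<^sup>+ y\<in>F. ennreal (1 / R powr (real DIM('a) + \<sigma>)) \<partial>lebesgue)"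
    using assms by (intro nn_integral_mono)
      (auto simp: indicator_def riesz_kernel_def near_def dist_norm intro!: ennreal_leI divide_left_mono powr_mono2 mult_pos_pos)
  also have "\<dots> = ennreal (1 / R powr (real DIM('a) + \<sigma>)) * emeasure lebesgue F"
    using F by (rule nn_integral_cmult_indicator)
  finally show "(\<integral>\<^sup>+ y\<in>F. riesz_kernel \<sigma> x y * indicator (- near R) (x, y) \<partial>lebesgue) \<le> ennreal (1 / R powr (real DIM('a) + \<sigma>)) * emeasure lebesgue F" .
qed

text \<open>The integral of \<open>\<bar>z\<bar> powr - (d + \<sigma>)\<close> over the ball of radius \<open>R\<close>.\<close>
definition riesz_mass :: "'a::euclidean_space itself \<Rightarrow> real \<Rightarrow> real \<Rightarrow> real" where
  "riesz_mass _ \<sigma> R = real DIM('a) * measure lebesgue (ball (0::'a) 1) * (R powr (- \<sigma>) / (- \<sigma>))"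

text \<open>The substitution \<open>y = x + z\<close> turns each inner integral into that of the
  kernel over the ball about 0, which is the same for all \<open>x\<close>.\<close>

lemma riesz_energy_near:
  assumes "0 < R" "- real DIM('a::euclidean_space) < \<sigma>" "\<sigma> < 0" and E: "(E :: 'a set) \<in> sets lebesgue"
  shows "riesz_energy \<sigma> (near R) E UNIV = ennreal (riesz_mass TYPE('a) \<sigma> R) * emeasure lebesgue E"
proof -
  have "(\<integral>\<^sup>+ y\<in>UNIV. riesz_kernel \<sigma> x y * indicator (near R) (x, y) \<partial>lebesgue) = ennreal (riesz_mass TYPE('a) \<sigma> R)" for x :: 'a
  proof -
    have "(\<integral>\<^sup>+ y\<in>UNIV. riesz_kernel \<sigma> x y * indicator (near R) (x, y) \<partial>lebesgue) = (\<integral>\<^sup>+ y\<in>ball x R. riesz_kernel \<sigma> x y \<partial>lborel)"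
      unfolding nn_integral_completion by (intro nn_integral_cong) (auto simp: near_def indicator_def)
    also have "\<dots> = (\<integral>\<^sup>+ y\<in>ball x R. riesz_kernel \<sigma> x y \<partial>distr lborel borel ((+) x))"
      unfolding lborel_distr_plus ..
    also have "\<dots> = (\<integral>\<^sup>+ z. riesz_kernel \<sigma> x (x + z) * indicator (ball x R) (x + z) \<partial>lborel)"
    proof (rule nn_integral_distr)
      show "(\<lambda>y. riesz_kernel \<sigma> x y * indicator (ball x R) y) \<in> borel_measurable (distr lborel borel ((+) x))"
        unfolding riesz_kernel_def measurable_distr_eq1
        by (intro borel_measurable_times_ennreal borel_measurable_indicator) auto
    qed simp
    also have "\<dots> = (\<integral>\<^sup>+ z\<in>ball (0::'a) R. ennreal (1 / norm z powr (real DIM('a) + \<sigma>)) \<partial>lborel)"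
      by (intro nn_integral_cong) (auto simp: riesz_kernel_def dist_norm indicator_def)
    also have "\<dots> = ennreal (riesz_mass TYPE('a) \<sigma> R)"
      using assms by (subst set_nn_integral_norm_powr_ball) (auto simp: riesz_mass_def)
    finally show ?thesis .
  qed
  then show ?thesis
    unfolding riesz_energy_def using E by (simp add: nn_integral_cmult_indicator)
qed

lemma riesz_H_eq_energy: "riesz_H \<sigma> R E = riesz_energy \<sigma> (near R) E (- E)"
proof -
  have "riesz_kernel \<sigma> x y * indicator (ball x R - E) y = riesz_kernel \<sigma> x y * indicator (near R) (x, y) * indicator (- E) y" for x y
    by (auto simp: near_def indicator_def)
  then show ?thesis
    unfolding riesz_H_def riesz_energy_def by simp
qed

declare emeasure_completion [simp del]

section \<open>Monotonicity and growth of the renormalizing constant\<close>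

lemma riesz_mass_nonneg: "\<sigma> < 0 \<Longrightarrow> 0 \<le> riesz_mass TYPE('a::euclidean_space) \<sigma> R"
  unfolding riesz_mass_def by (intro mult_nonneg_nonneg divide_nonneg_pos) auto

lemma riesz_gamma_eq_mass:
  "riesz_gamma TYPE('a::euclidean_space) \<sigma> R = riesz_mass TYPE('a) \<sigma> R - riesz_mass TYPE('a) \<sigma> 1"
  unfolding riesz_gamma_def riesz_mass_def by (simp add: diff_divide_distrib algebra_simps)

lemma measure_unit_ball_pos: "0 < measure lebesgue (ball (0::'a::euclidean_space) 1)"
  using content_ball_pos[of 1 "0::'a"] by simp

lemma strict_mono_riesz_gamma:
  assumes "\<sigma> < 0"
  shows "strict_mono_on {0<..} (riesz_gamma TYPE('a::euclidean_space) \<sigma>)"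
proof (rule strict_mono_onI)
  fix r s :: real assume "r \<in> {0<..}" "s \<in> {0<..}" "r < s"
  then have "(1 - r powr (- \<sigma>)) / \<sigma> < (1 - s powr (- \<sigma>)) / \<sigma>"
    using assms by (intro divide_strict_right_mono_neg) (auto intro!: powr_less_mono2)
  then show "riesz_gamma TYPE('a) \<sigma> r < riesz_gamma TYPE('a) \<sigma> s"
    unfolding riesz_gamma_def by (intro mult_strict_left_mono mult_pos_pos measure_unit_ball_pos) auto
qed

lemma filterlim_riesz_gamma:
  assumes "\<sigma> < 0"
  shows "filterlim (riesz_gamma TYPE('a::euclidean_space) \<sigma>) at_top at_top"
proof -
  \<comment> \<open>Chosen so that \<open>riesz_gamma\<close> equals
    \<open>c * (R powr (- \<sigma>) - 1)\<close>; it is positive because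
    \<open>\<sigma> < 0\<close>.\<close>
  define c where "c = real DIM('a) * measure lebesgue (ball (0::'a) 1) / (- \<sigma>)"
  have c: "0 < c"
    unfolding c_def using assms by (intro divide_pos_pos mult_pos_pos measure_unit_ball_pos) auto
  have "filterlim (\<lambda>R. R powr (- \<sigma>)) at_top at_top"
    unfolding powr_minus
    by (intro filterlim_inverse_at_top tendsto_neg_powr[OF assms] filterlim_ident
        eventually_mono[OF eventually_gt_at_top[of 0]]) auto
  then have "filterlim (\<lambda>R. - c + c * R powr (- \<sigma>)) at_top at_top"
    by (intro filterlim_tendsto_add_at_top[OF tendsto_const] filterlim_tendsto_pos_mult_at_top[OF tendsto_const c])
  moreover have "riesz_gamma TYPE('a) \<sigma> R = - c + c * R powr (- \<sigma>)" for R
    using assms by (simp add: riesz_gamma_def c_def field_simps)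
  ultimately show ?thesis by presburger
qed

section \<open>Finiteness of the energies\<close>

lemma riesz_energy_split_near:
  assumes "E \<in> sets lebesgue" "F \<in> sets lebesgue"
  shows "riesz_energy \<sigma> UNIV E F = riesz_energy \<sigma> (near R) E F + riesz_energy \<sigma> (- near R) E F"
  using riesz_energy_Un_domain[of "near R" "- near R" E F \<sigma>] assms near_sets by (auto simp: Compl_partition)

lemma riesz_energy_near_le:
  assumes "0 < R" "- real DIM('a::euclidean_space) < \<sigma>" "\<sigma> < 0" and E: "(E :: 'a set) \<in> lmeasurable"
  shows "riesz_energy \<sigma> (near R) E F \<le> ennreal (riesz_mass TYPE('a) \<sigma> R * measure lebesgue E)"
proof -
  have "riesz_energy \<sigma> (near R) E F \<le> riesz_energy \<sigma> (near R) E UNIV"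
    by (rule riesz_energy_mono) auto
  then show ?thesis
    using riesz_energy_near[of R \<sigma> E] assms
    by (simp add: emeasure_eq_measure2 ennreal_mult riesz_mass_nonneg)
qed

text \<open>Near pairs cost at most the kernel mass per point of \<open>E\<close>, whatever
  \<open>F\<close> is; far pairs are bounded by the size of the kernel at distance \<open>R\<close>.
  The case \<open>R = 1\<close> yields finiteness and later the semicontinuity estimate.\<close>

lemma riesz_energy_UNIV_le:
  assumes "0 < R" "- real DIM('a::euclidean_space) < \<sigma>" "\<sigma> < 0"
    and E: "(E :: 'a set) \<in> lmeasurable" and F: "F \<in> lmeasurable"
  shows "riesz_energy \<sigma> UNIV E F \<le>
    ennreal ((riesz_mass TYPE('a) \<sigma> R + measure lebesgue F / R powr (real DIM('a) + \<sigma>)) * measure lebesgue E)"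
proof -
  have far: "riesz_energy \<sigma> (- near R) E F \<le> ennreal (1 / R powr (real DIM('a) + \<sigma>) * measure lebesgue F * measure lebesgue E)"
    using riesz_energy_far_le[of R \<sigma> E F] assms
    by (simp add: emeasure_eq_measure2 ennreal_mult[symmetric] fmeasurableD)
  show ?thesis
    using add_mono[OF riesz_energy_near_le[OF assms(1-4)] far, of F] riesz_energy_split_near[of E F \<sigma> R] E F
    by (simp add: fmeasurableD distrib_right ennreal_plus[symmetric] riesz_mass_nonneg assms del: ennreal_plus)
qed

lemma near_mono: "R \<le> R' \<Longrightarrow> near R \<subseteq> near R'"
  by (auto simp: near_def)

section \<open>The functionals on a fixed set of finite measure\<close>

text \<open>Real-valued so that differences can be formed. \<open>enn2real\<close> would send an
  infinite energy to 0; \<open>ennreal_riesz_near\<close> excludes this for sets of finite measure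
  and \<open>R > 0\<close>.\<close>

definition riesz_near :: "real \<Rightarrow> real \<Rightarrow> 'a::euclidean_space set \<Rightarrow> real" where
  "riesz_near \<sigma> R E = enn2real (riesz_energy \<sigma> (near R) E E)"

definition riesz_self :: "real \<Rightarrow> 'a::euclidean_space set \<Rightarrow> real" where
  "riesz_self \<sigma> E = enn2real (riesz_energy \<sigma> UNIV E E)"

context
  fixes \<sigma> :: real and E :: "'a::euclidean_space set"
  assumes \<sigma>: "- real DIM('a) < \<sigma>" "\<sigma> < 0" and E: "E \<in> lmeasurable"
begin

lemma ennreal_riesz_near: "0 < R \<Longrightarrow> ennreal (riesz_near \<sigma> R E) = riesz_energy \<sigma> (near R) E E"
  using order.strict_trans1[OF riesz_energy_near_le[OF _ \<sigma> E, of R E] ennreal_less_top]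
  by (simp add: riesz_near_def)

lemma ennreal_riesz_self: "ennreal (riesz_self \<sigma> E) = riesz_energy \<sigma> UNIV E E"
  using order.strict_trans1[OF riesz_energy_UNIV_le[OF _ \<sigma> E E, of 1] ennreal_less_top]
  by (simp add: riesz_self_def)

lemma riesz_near_nonneg: "0 \<le> riesz_near \<sigma> R E"
  by (simp add: riesz_near_def)

lemma riesz_self_nonneg: "0 \<le> riesz_self \<sigma> E"
  by (simp add: riesz_self_def)

lemma riesz_near_le_self: "0 < R \<Longrightarrow> riesz_near \<sigma> R E \<le> riesz_self \<sigma> E"
  using riesz_energy_mono[of "near R" UNIV E E E E \<sigma>]
  by (simp flip: ennreal_riesz_near ennreal_riesz_self add: riesz_self_nonneg)

lemma riesz_near_mono: "0 < R \<Longrightarrow> R \<le> R' \<Longrightarrow> riesz_near \<sigma> R E \<le> riesz_near \<sigma> R' E"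
  using riesz_energy_mono[of "near R" "near R'" E E E E \<sigma>] near_mono[of R R']
  by (simp flip: ennreal_riesz_near add: riesz_near_nonneg)

lemma riesz_self_le_near:
  assumes "0 < R"
  shows "riesz_self \<sigma> E \<le> riesz_near \<sigma> R E + (measure lebesgue E)\<^sup>2 / R powr (real DIM('a) + \<sigma>)"
proof -
  have "ennreal (riesz_self \<sigma> E) \<le> ennreal (riesz_near \<sigma> R E) +
      ennreal (1 / R powr (real DIM('a) + \<sigma>)) * emeasure lebesgue E * emeasure lebesgue E"
    using riesz_energy_far_le[OF assms \<sigma>(1), of E E] E assms
    by (simp add: ennreal_riesz_near ennreal_riesz_self riesz_energy_split_near[of E E \<sigma> R] fmeasurableD add_left_mono)
  also have "\<dots> = ennreal (riesz_near \<sigma> R E + (measure lebesgue E)\<^sup>2 / R powr (real DIM('a) + \<sigma>))"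
    using E by (simp add: emeasure_eq_measure2 ennreal_mult[symmetric] ennreal_plus[symmetric] riesz_near_nonneg power2_eq_square del: ennreal_plus)
  finally show ?thesis
    by (subst (asm) ennreal_le_iff) (auto simp: riesz_near_nonneg)
qed

lemma riesz_near_le_mass: "0 < R \<Longrightarrow> riesz_near \<sigma> R E \<le> riesz_mass TYPE('a) \<sigma> R * measure lebesgue E"
  using riesz_energy_near_le[OF _ \<sigma> E, of R E]
  by (simp flip: ennreal_riesz_near add: riesz_mass_nonneg \<sigma>)

text \<open>\<open>E\<close> and its complement fill the space, so \<open>riesz_H\<close> and the
  near self-energy add up to the near energy of \<open>E\<close> against \<open>UNIV\<close>. The
  self-energy is finite and may be subtracted.\<close>

lemma riesz_H_eq:
  assumes "0 < R"
  shows "riesz_H \<sigma> R E = ennreal (riesz_mass TYPE('a) \<sigma> R * measure lebesgue E - riesz_near \<sigma> R E)"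
proof -
  have "riesz_H \<sigma> R E + ennreal (riesz_near \<sigma> R E) = riesz_energy \<sigma> (near R) E (- E \<union> E)"
    using assms E near_sets
    by (subst riesz_energy_Un_right) (auto simp: riesz_H_eq_energy ennreal_riesz_near fmeasurableD Compl_in_sets_lebesgue)
  also have "\<dots> = ennreal (riesz_mass TYPE('a) \<sigma> R * measure lebesgue E)"
    using E by (simp add: riesz_energy_near[OF assms \<sigma>] fmeasurableD emeasure_eq_measure2 ennreal_mult riesz_mass_nonneg \<sigma>)
  finally have "riesz_H \<sigma> R E = ennreal (riesz_mass TYPE('a) \<sigma> R * measure lebesgue E) - ennreal (riesz_near \<sigma> R E)"
    by (metis ennreal_add_diff_cancel_right ennreal_neq_top)
  then show ?thesis
    by (simp add: ennreal_minus riesz_near_nonneg)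
qed

lemma riesz_H_hat_eq:
  assumes "0 < R"
  shows "riesz_H_hat \<sigma> R E = ereal (riesz_mass TYPE('a) \<sigma> 1 * measure lebesgue E - riesz_near \<sigma> R E)"
  \<comment> \<open>This bound makes the real difference in \<open>riesz_H_eq\<close> nonnegative,
    so \<open>ennreal\<close> does not truncate it. Subtracting \<open>riesz_gamma\<close> then
    replaces the mass at \<open>R\<close> by the mass at 1.\<close>
  using riesz_near_le_mass[OF assms]
  by (simp add: riesz_H_hat_def riesz_H_eq[OF assms] riesz_gamma_eq_mass algebra_simps)

lemma riesz_J_hat_eq:
  "riesz_J_hat \<sigma> E = ereal (riesz_mass TYPE('a) \<sigma> 1 * measure lebesgue E - riesz_self \<sigma> E)"
proof -
  have "(\<integral>\<^sup>+ x\<in>E. (\<integral>\<^sup>+ y\<in>E. riesz_kernel \<sigma> x y \<partial>lebesgue) \<partial>lebesgue) = riesz_energy \<sigma> UNIV E E"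
    by (simp add: riesz_energy_def)
  then show ?thesis
    by (simp add: riesz_J_hat_def ennreal_riesz_self[symmetric] riesz_self_nonneg riesz_mass_def)
qed

lemma strict_mono_riesz_H:
  assumes "0 < measure lebesgue E"
  shows "strict_mono_on {0<..} (\<lambda>R. riesz_H \<sigma> R E)"
proof (rule strict_mono_onI)
  fix r s :: real assume rs: "r \<in> {0<..}" "s \<in> {0<..}" "r < s"
  define A where "A = (near s - near r :: ('a \<times> 'a) set)"
  have A: "A \<in> sets borel" unfolding A_def using near_sets by blast
  have "near s = near r \<union> A" "near r \<inter> A = {}"
    using rs by (auto simp: A_def near_def)
  then have H: "riesz_H \<sigma> s E = riesz_H \<sigma> r E + riesz_energy \<sigma> A E (- E)"
    using E A near_sets by (simp add: riesz_H_eq_energy riesz_energy_Un_domain fmeasurableD Compl_in_sets_lebesgue)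
  have "riesz_energy \<sigma> A E (- E) \<noteq> 0"
  proof
    assume "riesz_energy \<sigma> A E (- E) = 0"
    then have "AE x in lebesgue. x \<in> E \<longrightarrow> (AE y in lebesgue. y \<in> - E \<longrightarrow> (x, y) \<in> A \<longrightarrow> riesz_kernel \<sigma> x y = 0)"
      using E A by (subst (asm) riesz_energy_eq_0_iff) (auto simp: fmeasurableD Compl_in_sets_lebesgue)
    \<comment> \<open>On \<open>A\<close> the distance is at least \<open>r > 0\<close>, so the
      kernel is nonzero there and almost no such \<open>y\<close> can lie outside
      \<open>E\<close>.\<close>
    then have "AE x in lebesgue. x \<in> E \<longrightarrow> (AE y in lebesgue. r \<le> dist x y \<longrightarrow> dist x y < s \<longrightarrow> y \<in> E)"
      using rs by (auto elim!: eventually_mono simp: A_def near_def riesz_kernel_def)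
    then have "emeasure lebesgue E = 0"
      using rs E by (intro emeasure_eq_0_if_annuli_subset) auto
    then show False using assms by (simp add: measure_def)
  qed
  \<comment> \<open>A positive increment gives strictness because
    \<open>riesz_H \<sigma> r E\<close> is finite.\<close>
  then show "riesz_H \<sigma> r E < riesz_H \<sigma> s E"
    unfolding H using rs by (simp add: riesz_H_eq ennreal_add_left_cancel_less zero_less_iff_neq_zero)
qed

lemma tendsto_riesz_H:
  assumes "0 < measure lebesgue E"
  shows "((\<lambda>R. riesz_H \<sigma> R E) \<longlongrightarrow> \<infinity>) at_top"
proof -
  \<comment> \<open>This is the value of \<open>riesz_J_hat\<close> plus \<open>riesz_gamma\<close>
    times the measure of \<open>E\<close>; it bounds \<open>riesz_H\<close> from below since the
    near self-energy is at most the full one.\<close>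
  let ?g = "\<lambda>R. (riesz_mass TYPE('a) \<sigma> 1 * measure lebesgue E - riesz_self \<sigma> E) + measure lebesgue E * riesz_gamma TYPE('a) \<sigma> R"
  have "filterlim ?g at_top at_top"
    by (intro filterlim_tendsto_add_at_top[OF tendsto_const]
        filterlim_tendsto_pos_mult_at_top[OF tendsto_const assms] filterlim_riesz_gamma \<sigma>)
  then have "((\<lambda>R. ennreal (?g R)) \<longlongrightarrow> \<infinity>) at_top"
    by (simp add: ennreal_tendsto_top_eq_at_top)
  moreover have "\<forall>\<^sub>F R in at_top. ennreal (?g R) \<le> riesz_H \<sigma> R E"
    using eventually_gt_at_top[of 0]
  proof eventually_elim
    case (elim R)
    then show ?case
      using riesz_near_le_self[OF elim]
      by (simp add: riesz_H_eq riesz_gamma_eq_mass algebra_simps ennreal_leI)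
  qed
  ultimately show ?thesis
    by (rule tendsto_sandwich[where h = "\<lambda>_. \<infinity>", rotated 2, OF _ tendsto_const _ always_eventually]) simp
qed

lemma antimono_riesz_H_hat: "antimono_on {0<..} (\<lambda>R. riesz_H_hat \<sigma> R E)"
  by (auto simp: monotone_on_def riesz_H_hat_eq riesz_near_mono)

text \<open>The mass terms cancel and leave
  \<open>riesz_self \<sigma> E - riesz_near \<sigma> R E\<close>, the energy of the far
  pairs.\<close>

lemma riesz_H_hat_minus_J_hat:
  assumes "0 < R"
  shows "0 \<le> riesz_H_hat \<sigma> R E - riesz_J_hat \<sigma> E"
    and "riesz_H_hat \<sigma> R E - riesz_J_hat \<sigma> E \<le> ereal ((measure lebesgue E)\<^sup>2 / R powr (real DIM('a) + \<sigma>))"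
  using riesz_near_le_self[OF assms] riesz_self_le_near[OF assms]
  by (simp_all add: riesz_H_hat_eq[OF assms] riesz_J_hat_eq)

lemma tendsto_riesz_H_hat: "((\<lambda>R. riesz_H_hat \<sigma> R E) \<longlongrightarrow> riesz_J_hat \<sigma> E) at_top"
proof -
  have "((\<lambda>R. riesz_self \<sigma> E - (measure lebesgue E)\<^sup>2 * R powr - (real DIM('a) + \<sigma>)) \<longlongrightarrow> riesz_self \<sigma> E - (measure lebesgue E)\<^sup>2 * 0) at_top"
    using \<sigma> by (intro tendsto_intros tendsto_neg_powr filterlim_ident) auto
  then have lower: "((\<lambda>R. riesz_self \<sigma> E - (measure lebesgue E)\<^sup>2 * R powr - (real DIM('a) + \<sigma>)) \<longlongrightarrow> riesz_self \<sigma> E) at_top"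
    by simp
  have "((\<lambda>R. riesz_near \<sigma> R E) \<longlongrightarrow> riesz_self \<sigma> E) at_top"
  proof (rule tendsto_sandwich[OF _ _ lower tendsto_const])
    show "\<forall>\<^sub>F R in at_top. riesz_self \<sigma> E - (measure lebesgue E)\<^sup>2 * R powr - (real DIM('a) + \<sigma>) \<le> riesz_near \<sigma> R E"
      using eventually_gt_at_top[of 0]
    proof eventually_elim
      case (elim R)
      then show ?case
        using riesz_self_le_near[OF elim] unfolding powr_minus_divide by simp
    qed
    show "\<forall>\<^sub>F R in at_top. riesz_near \<sigma> R E \<le> riesz_self \<sigma> E"
      using eventually_gt_at_top[of 0] by eventually_elim (rule riesz_near_le_self)
  qed
  then have "((\<lambda>R. ereal (riesz_mass TYPE('a) \<sigma> 1 * measure lebesgue E - riesz_near \<sigma> R E)) \<longlongrightarrow> riesz_J_hat \<sigma> E) at_top"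
    unfolding riesz_J_hat_eq by (intro tendsto_ereal tendsto_intros)
  then show ?thesis
    by (rule Lim_transform_eventually)
      (use eventually_gt_at_top[of 0] in eventually_elim, simp add: riesz_H_hat_eq)
qed

end

section \<open>Semicontinuity of the limit functional and Gamma-convergence\<close>

text \<open>A pair in \<open>F \<times> F\<close> either lies in \<open>E \<times> E\<close> or has
  a first or second point in \<open>F - E\<close>. By symmetry each of the latter two families
  contributes at most the energy of \<open>F - E\<close> against \<open>F\<close>, hence the factor
  2.\<close>

lemma riesz_energy_excess:
  assumes E: "E \<in> sets lebesgue" and F: "F \<in> sets lebesgue"
  shows "riesz_energy \<sigma> UNIV F F \<le> riesz_energy \<sigma> UNIV E E + 2 * riesz_energy \<sigma> UNIV (F - E) F"
proof -
  let ?e = "riesz_energy \<sigma> UNIV"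
  have sym: "sym UNIV" by (simp add: sym_def)
  have right: "?e G F = ?e G (F \<inter> E) + ?e G (F - E)" if "G \<in> sets lebesgue" for G
    using riesz_energy_Un_right[of UNIV G "F \<inter> E" "F - E" \<sigma>] that E F
    by (auto simp: Int_Diff_Un Int_Diff_disjoint)
  have comm: "?e G H = ?e H G" if "G \<in> sets lebesgue" "H \<in> sets lebesgue" for G H
    using riesz_energy_commute[OF _ that sym] by simp
  have "?e F F = ?e F (F \<inter> E) + ?e F (F - E)"
    using F by (rule right)
  also have "?e F (F - E) = ?e (F - E) F"
    using E F by (intro comm) auto
  also have "?e F (F \<inter> E) = ?e (F \<inter> E) F"
    using E F by (intro comm) auto
  also have "\<dots> = ?e (F \<inter> E) (F \<inter> E) + ?e (F \<inter> E) (F - E)"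
    using E F by (intro right) auto
  also have "?e (F \<inter> E) (F - E) = ?e (F - E) (F \<inter> E)"
    using E F by (intro comm) auto
  also have "?e (F \<inter> E) (F \<inter> E) + ?e (F - E) (F \<inter> E) + ?e (F - E) F \<le> ?e E E + ?e (F - E) F + ?e (F - E) F"
    by (intro add_mono riesz_energy_mono) auto
  finally show ?thesis by (simp add: mult_2 add.assoc)
qed

lemma riesz_self_le:
  assumes \<sigma>: "- real DIM('a::euclidean_space) < \<sigma>" "\<sigma> < 0"
    and E: "(E :: 'a set) \<in> lmeasurable" and F: "F \<in> lmeasurable"
  shows "riesz_self \<sigma> F \<le> riesz_self \<sigma> E + 2 * ((riesz_mass TYPE('a) \<sigma> 1 + measure lebesgue F) * measure lebesgue (F - E))"
proof -
  have nn: "0 \<le> (riesz_mass TYPE('a) \<sigma> 1 + measure lebesgue F) * measure lebesgue (F - E)"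
    using riesz_mass_nonneg[OF \<sigma>(2), where 'a='a] by simp
  have "ennreal (riesz_self \<sigma> F) \<le> ennreal (riesz_self \<sigma> E) + 2 * riesz_energy \<sigma> UNIV (F - E) F"
    using riesz_energy_excess[of E F \<sigma>] by (simp add: ennreal_riesz_self \<sigma> E F fmeasurableD)
  also have "\<dots> \<le> ennreal (riesz_self \<sigma> E) + ennreal 2 * ennreal ((riesz_mass TYPE('a) \<sigma> 1 + measure lebesgue F) * measure lebesgue (F - E))"
    \<comment> \<open>Splitting at radius 1 makes the far factor
      \<open>1 powr (d + \<sigma>)\<close> equal to 1.\<close>
    using riesz_energy_UNIV_le[of 1 \<sigma> "F - E" F] \<sigma> E F
    by (intro add_left_mono mult_mono) (auto simp: fmeasurable.Diff)
  also have "\<dots> = ennreal (riesz_self \<sigma> E + 2 * ((riesz_mass TYPE('a) \<sigma> 1 + measure lebesgue F) * measure lebesgue (F - E)))"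
    using nn by (subst ennreal_plus) (auto simp: ennreal_mult riesz_self_def)
  finally show ?thesis
    using nn by (subst (asm) ennreal_le_iff) (auto simp: riesz_self_def)
qed

text \<open>The \<open>L1\<close> distance of two indicators is the measure of the symmetric
  difference, so the measures of both one-sided differences tend to 0.\<close>

lemma L1_set_convD:
  assumes conv: "L1_set_conv En E" and En: "\<And>n. En n \<in> lmeasurable" and E: "E \<in> lmeasurable"
  shows "(\<lambda>n. measure lebesgue (En n - E)) \<longlonglongrightarrow> 0"
    and "(\<lambda>n. measure lebesgue (En n)) \<longlonglongrightarrow> measure lebesgue E"
proof -
  have eq: "(\<integral>\<^sup>+ x. ennreal \<bar>indicat_real (En n) x - indicat_real E x\<bar> \<partial>lebesgue)
      = ennreal (measure lebesgue (En n - E) + measure lebesgue (E - En n))" for n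
  proof -
    have "(\<integral>\<^sup>+ x. ennreal \<bar>indicat_real (En n) x - indicat_real E x\<bar> \<partial>lebesgue)
      = (\<integral>\<^sup>+ x. indicator ((En n - E) \<union> (E - En n)) x \<partial>lebesgue)"
      by (intro nn_integral_cong) (auto simp: indicator_def)
    also have "\<dots> = emeasure lebesgue ((En n - E) \<union> (E - En n))"
      using E En[of n] by (intro nn_integral_indicator) (auto simp: fmeasurableD)
    also have "\<dots> = emeasure lebesgue (En n - E) + emeasure lebesgue (E - En n)"
      using E En[of n] by (intro plus_emeasure[symmetric]) (auto simp: fmeasurableD)
    finally show ?thesis
      using E En[of n] by (simp add: emeasure_eq_measure2 fmeasurable.Diff)
  qed
  have lim: "(\<lambda>n. measure lebesgue (En n - E) + measure lebesgue (E - En n)) \<longlonglongrightarrow> 0"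
    using conv unfolding L1_set_conv_def eq by (subst (asm) ennreal_0[symmetric], subst (asm) tendsto_ennreal_iff) auto
  show 1: "(\<lambda>n. measure lebesgue (En n - E)) \<longlonglongrightarrow> 0"
    by (rule tendsto_sandwich[OF _ _ tendsto_const lim]) auto
  have 2: "(\<lambda>n. measure lebesgue (E - En n)) \<longlonglongrightarrow> 0"
    by (rule tendsto_sandwich[OF _ _ tendsto_const lim]) auto
  \<comment> \<open>The measure of \<open>E \<union> En n\<close> is computed in two ways.\<close>
  have "measure lebesgue (En n) = measure lebesgue E + measure lebesgue (En n - E) - measure lebesgue (E - En n)" for n
    using measure_Un2[OF E En[of n]] measure_Un2[OF En[of n] E] by (simp add: Un_commute)
  then show "(\<lambda>n. measure lebesgue (En n)) \<longlonglongrightarrow> measure lebesgue E"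
    using tendsto_diff[OF tendsto_add[OF tendsto_const[of "measure lebesgue E"] 1] 2] by simp
qed

lemma Gamma_liminf:
  assumes \<sigma>: "- real DIM('a::euclidean_space) < \<sigma>" "\<sigma> < 0" and R: "\<And>n::nat. 0 < R n"
    and E: "(E :: 'a set) \<in> lmeasurable" and En: "\<And>n. En n \<in> lmeasurable" and conv: "L1_set_conv En E"
  shows "riesz_J_hat \<sigma> E \<le> liminf (\<lambda>n. riesz_H_hat \<sigma> (R n) (En n))"
proof -
  let ?\<kappa> = "riesz_mass TYPE('a) \<sigma> 1"
  \<comment> \<open>A lower bound for \<open>riesz_J_hat \<sigma> (En n)\<close> by
    \<open>riesz_self_le\<close>, and hence for the functional at radius \<open>R n\<close>. The
    measures of \<open>En n\<close> converge and those of \<open>En n - E\<close> vanish, so it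
    tends to \<open>riesz_J_hat \<sigma> E\<close>.\<close>
  let ?l = "\<lambda>n. ?\<kappa> * measure lebesgue (En n) -
      (riesz_self \<sigma> E + 2 * ((?\<kappa> + measure lebesgue (En n)) * measure lebesgue (En n - E)))"
  have "?l \<longlonglongrightarrow> ?\<kappa> * measure lebesgue E - (riesz_self \<sigma> E + 2 * ((?\<kappa> + measure lebesgue E) * 0))"
    by (intro tendsto_intros L1_set_convD[OF conv En E])
  then have "(\<lambda>n. ereal (?l n)) \<longlonglongrightarrow> riesz_J_hat \<sigma> E"
    by (simp add: riesz_J_hat_eq[OF \<sigma> E])
  then have "riesz_J_hat \<sigma> E = liminf (\<lambda>n. ereal (?l n))"
    by (intro lim_imp_Liminf[symmetric]) auto
  also have "\<dots> \<le> liminf (\<lambda>n. riesz_H_hat \<sigma> (R n) (En n))"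
  proof (intro Liminf_mono always_eventually allI)
    fix n
    show "ereal (?l n) \<le> riesz_H_hat \<sigma> (R n) (En n)"
      using riesz_self_le[OF \<sigma> E En[of n]] riesz_near_le_self[OF \<sigma> En[of n] R[of n]]
      by (simp add: riesz_H_hat_eq[OF \<sigma> En R])
  qed
  finally show ?thesis .
qed

lemma Gamma_limit_riesz:
  assumes \<sigma>: "- real DIM('a::euclidean_space) < \<sigma>" "\<sigma> < 0"
  shows "Gamma_limit_at_top (riesz_H_hat \<sigma> :: real \<Rightarrow> 'a set \<Rightarrow> ereal) (riesz_J_hat \<sigma>)"
  unfolding Gamma_limit_at_top_def
proof (intro allI impI conjI ballI)
  fix R :: "nat \<Rightarrow> real" and E :: "'a set"
  assume R: "\<forall>n. 0 < R n" "filterlim R at_top sequentially" and E: "E \<in> lmeasurable"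
  show "riesz_J_hat \<sigma> E \<le> liminf (\<lambda>n. riesz_H_hat \<sigma> (R n) (En n))"
    if "\<forall>n. En n \<in> lmeasurable" "L1_set_conv En E" for En
    using that R E by (intro Gamma_liminf[OF \<sigma>]) auto
  have "(\<lambda>n. riesz_H_hat \<sigma> (R n) E) \<longlonglongrightarrow> riesz_J_hat \<sigma> E"
    using filterlim_compose[OF tendsto_riesz_H_hat[OF \<sigma> E] R(2)] .
  then have "limsup (\<lambda>n. riesz_H_hat \<sigma> (R n) E) = riesz_J_hat \<sigma> E"
    by (intro lim_imp_Limsup) auto
  then show "\<exists>En. (\<forall>n. En n \<in> lmeasurable) \<and> L1_set_conv En E \<and> riesz_J_hat \<sigma> E \<ge> limsup (\<lambda>n. riesz_H_hat \<sigma> (R n) (En n))"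
    using E by (intro exI[of _ "\<lambda>_. E"]) (simp add: L1_set_conv_def)
qed

theorem proposition2p1:
  fixes \<sigma> :: real
  assumes "- real DIM('a::euclidean_space) < \<sigma>" and "\<sigma> < 0"
  shows
    "strict_mono_on {0<..} (riesz_gamma TYPE('a) \<sigma>) \<and>
     filterlim (riesz_gamma TYPE('a) \<sigma>) at_top at_top \<and>
     (\<forall>E :: 'a set. E \<in> lmeasurable \<longrightarrow> 0 < measure lebesgue E \<longrightarrow>
        strict_mono_on {0<..} (\<lambda>R. riesz_H \<sigma> R E) \<and>
        ((\<lambda>R. riesz_H \<sigma> R E) \<longlongrightarrow> \<infinity>) at_top) \<and>
     (\<forall>E :: 'a set. E \<in> lmeasurable \<longrightarrow>
        antimono_on {0<..} (\<lambda>R. riesz_H_hat \<sigma> R E) \<and>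
        ((\<lambda>R. riesz_H_hat \<sigma> R E) \<longlongrightarrow> riesz_J_hat \<sigma> E) at_top) \<and>
     (\<forall>R > 0. \<forall>E :: 'a set. E \<in> lmeasurable \<longrightarrow>
        0 \<le> riesz_H_hat \<sigma> R E - riesz_J_hat \<sigma> E \<and>
        riesz_H_hat \<sigma> R E - riesz_J_hat \<sigma> E
          \<le> ereal ((measure lebesgue E)\<^sup>2 / R powr (real DIM('a) + \<sigma>))) \<and>
     Gamma_limit_at_top (riesz_H_hat \<sigma> :: real \<Rightarrow> 'a set \<Rightarrow> ereal) (riesz_J_hat \<sigma>)"
  using assms by (intro conjI allI impI strict_mono_riesz_gamma filterlim_riesz_gamma strict_mono_riesz_H
      tendsto_riesz_H antimono_riesz_H_hat tendsto_riesz_H_hat riesz_H_hat_minus_J_hat Gamma_limit_riesz)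

end
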